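(* Let $n=pqr$, where $p,q,r$ are distinct odd primes. Then $J_n>n^{1/3}$.
   Context: For a positive integer $n$, the $n$th cyclotomic polynomial is $\Phi_n(x)=\prod_{1\le m\le n,\ \gcd(m,n)=1}(x-e^{2\pi i m/n})=\sum_{k\in\mathbb{Z}}a_n(k)x^k$, where $a_n(k)=0$ for $k<0$ and for $k>\varphi(n)$. A coefficient $a_n(k)$ is called jumping up if $a_n(k)=a_n(k-1)+1$. $J_n$ denotes the number of integers $k$ for which $a_n(k)$ is jumping up. *)

theory Defs
  imports
    Complex_Main
    "HOL-Computational_Algebra.Polynomial"
    "HOL-Computational_Algebra.Primes"
begin

definition cyclotomic :: "nat \<Rightarrow> complex poly" where
  "cyclotomic n =
     (\<Prod>m | 1 \<le> m \<and> m \<le> n \<and> coprime m n.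
        [:- exp (2 * of_real pi * \<i> * of_nat m / of_nat n), 1:])"

text \<open>The index ranges over all integers, so that the step from \<open>k = - 1\<close> to \<open>k = 0\<close> is one of
  the steps considered. The coefficients are integers, but are kept here in \<^typ>\<open>complex\<close>.\<close>

definition cyclotomic_coeff :: "nat \<Rightarrow> int \<Rightarrow> complex" where
  "cyclotomic_coeff n k = (if k < 0 then 0 else coeff (cyclotomic n) (nat k))"

definition jumping_up :: "nat \<Rightarrow> int \<Rightarrow> bool" where
  "jumping_up n k \<longleftrightarrow> cyclotomic_coeff n k = cyclotomic_coeff n (k - 1) + 1"

definition num_jumping_up :: "nat \<Rightarrow> nat" where
  "num_jumping_up n = card {k. jumping_up n k}"

text \<open>So \<^const>\<open>card\<close> is applied to a finite set only.\<close>

lemma finite_jumping_up: "finite {k. jumping_up n k}"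
proof (rule finite_subset)
  show "{k. jumping_up n k} \<subseteq> {0..int (degree (cyclotomic n)) + 1}"
  proof
    fix k assume "k \<in> {k. jumping_up n k}"
    then have jump: "cyclotomic_coeff n k = cyclotomic_coeff n (k - 1) + 1"
      by (simp add: jumping_up_def)
    have "\<not> k < 0"
      using jump by (auto simp: cyclotomic_coeff_def)
    moreover have "\<not> k > int (degree (cyclotomic n)) + 1"
    proof
      assume k: "k > int (degree (cyclotomic n)) + 1"
      then have "coeff (cyclotomic n) (nat k) = 0" "coeff (cyclotomic n) (nat (k - 1)) = 0"
        by (auto intro!: coeff_eq_0)
      with jump k show False by (simp add: cyclotomic_coeff_def)
    qed
    ultimately show "k \<in> {0..int (degree (cyclotomic n)) + 1}" by simp
  qed
qed simp

end

theory Submission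
  imports
    Defs
    "HOL-Computational_Algebra.Fundamental_Theorem_Algebra"
    "HOL-Analysis.Complex_Transcendental"
    "HOL-Number_Theory.Cong"
begin

text \<open>
  Let \<open>f = (1 - x) \<Phi>\<^sub>n\<close>, whose coefficients are the jumps of \<open>\<Phi>\<^sub>n\<close>. They all lie in
  \<open>{-1, 0, 1}\<close> and sum to \<open>f(1) = 0\<close>, so \<open>2 J\<^sub>n\<close> is the sum of their squares, and Parseval
  over the \<open>n\<close>-th roots of unity gives \<open>2 n J\<^sub>n = \<Sum> \<bar>f(z)\<bar>\<^sup>2\<close>. For \<open>z\<close> of order \<open>p q\<close>,
  \<open>f(z) (1 - z^(p r)) (1 - z^(q r)) = r (1 - z^p) (1 - z^q) (1 - z^r)\<close>. As \<open>z \<mapsto> z^r\<close>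
  permutes these \<open>z\<close> and the product of \<open>1 - z\<close> over them is \<open>\<Phi>\<^sub>p\<^sub>q(1) = 1\<close>, the product of
  \<open>\<bar>f(z)\<bar> / r\<close> is \<open>1\<close>, and by AM-GM they contribute at least \<open>r\<^sup>2 (p - 1) (q - 1)\<close>. Adding
  the orders \<open>p r\<close> and \<open>q r\<close> and applying AM-GM once more yields \<open>J\<^sub>n\<^sup>3 > n\<close> unless the two smallest primes are
  3, 5 or 3, 7, where a direct estimate does.
\<close>

section \<open>Roots of unity\<close>

definition unity_roots :: "nat \<Rightarrow> complex set" where
  "unity_roots n = {z. z ^ n = 1}"

lemma finite_unity_roots: "n > 0 \<Longrightarrow> finite (unity_roots n)"
  unfolding unity_roots_def using bij_betw_roots_unity[of n] bij_betw_finite by fastforce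

lemma card_unity_roots: "n > 0 \<Longrightarrow> card (unity_roots n) = n"
  by (simp add: unity_roots_def card_roots_unity_eq)

text \<open>Bezout writes the gcd as a difference of multiples of the exponents. This evaluates
  every intersection in the inclusion-exclusion arguments below.\<close>

lemma unity_roots_Int: "unity_roots a \<inter> unity_roots b = unity_roots (gcd a b)"
proof (cases "a = 0")
  case False
  show ?thesis
  proof (intro set_eqI iffI)
    fix z assume "z \<in> unity_roots a \<inter> unity_roots b"
    then have z: "z ^ a = 1" "z ^ b = 1" by (auto simp: unity_roots_def)
    obtain x y where "a * x = b * y + gcd a b" using bezout_nat[OF False] by blast
    then have "z ^ (a * x) = z ^ (b * y) * z ^ gcd a b" by (simp add: power_add)
    with z show "z \<in> unity_roots (gcd a b)" by (simp add: power_mult unity_roots_def)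
  next
    fix z assume "z \<in> unity_roots (gcd a b)"
    then have z: "z ^ gcd a b = 1" by (simp add: unity_roots_def)
    have "z ^ a = 1" "z ^ b = 1"
      using z by (metis dvdE gcd_dvd1 gcd_dvd2 power_mult power_one)+
    then show "z \<in> unity_roots a \<inter> unity_roots b" by (simp add: unity_roots_def)
  qed
qed (auto simp: unity_roots_def)

text \<open>The derivative of X^n - 1 vanishes at most at 0, which is not a root, so the polynomial
  is squarefree and splits into distinct linear factors.\<close>

lemma prod_unity_roots:
  assumes "n > 0"
  shows "(\<Prod>z\<in>unity_roots n. [:- z, 1:]) = monom 1 n - 1"
proof -
  let ?p = "monom 1 n - 1 :: complex poly"
  have root: "poly ?p z = 0 \<longleftrightarrow> z \<in> unity_roots n" for z
    by (simp add: poly_monom unity_roots_def)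
  have "rsquarefree ?p"
    unfolding rsquarefree_roots using assms
    by (auto simp: pderiv_diff pderiv_monom poly_monom power_0_left)
  moreover have "lead_coeff ?p = 1"
  proof -
    have "degree ?p = n"
      using assms degree_add_eq_left[of "-1::complex poly" "monom 1 n"] by (simp add: degree_monom_eq)
    then show ?thesis using assms by simp
  qed
  ultimately show ?thesis
    using complex_poly_decompose_rsquarefree[of ?p]
    by (simp only: root Collect_mem_eq smult_1_left)
qed

text \<open>Cancelling X - 1 from X^n - 1 leaves the geometric sum, whose value at 1 is n.\<close>

lemma prod_one_minus_unity_roots:
  assumes "n > 0"
  shows "(\<Prod>z\<in>unity_roots n - {1}. 1 - z) = of_nat n"
proof -
  have 1: "(1::complex) \<in> unity_roots n" by (simp add: unity_roots_def)
  have "[:-1, 1:] * (\<Prod>z\<in>unity_roots n - {1}. [:- z, 1:]) = monom 1 n - (1 :: complex poly)"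
    unfolding prod_unity_roots[OF assms, symmetric]
    using prod.remove[OF finite_unity_roots[OF assms] 1, of "\<lambda>z. [:- z, 1:]"] by simp
  also have "\<dots> = [:-1, 1:] * (\<Sum>i<n. monom 1 i)"
  proof -
    have "monom 1 1 - (1 :: complex poly) = [:-1, 1:]" by (simp add: monom_Suc monom_0 one_pCons)
    then show ?thesis using power_diff_1_eq[of "monom 1 1 :: complex poly" n] by (simp add: monom_power)
  qed
  finally have "(\<Prod>z\<in>unity_roots n - {1}. [:- z, 1:]) = (\<Sum>i<n. monom 1 i :: complex poly)"
    by (simp only: mult_cancel_left) simp
  then have "poly (\<Prod>z\<in>unity_roots n - {1}. [:- z, 1:]) 1 = poly (\<Sum>i<n. monom 1 i :: complex poly) 1"
    by simp
  then show ?thesis by (simp add: poly_prod poly_sum poly_monom)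
qed

text \<open>The inverse map is the power with exponent \<open>s\<close>, an inverse of
  \<open>r\<close> modulo \<open>n\<close>.\<close>

lemma bij_betw_unity_roots_power:
  assumes "n > 0" "coprime r n"
  shows "bij_betw (\<lambda>z. z ^ r) (unity_roots n) (unity_roots n)"
proof -
  obtain s where "[r * s = 1] (mod n)" using cong_solve_coprime_nat[OF assms(2)] by auto
  have inv: "z ^ (r * s) = z" if "z \<in> unity_roots n" for z
  proof -
    have "z ^ m = z ^ (m mod n)" for m
    proof -
      have "z ^ m = (z ^ n) ^ (m div n) * z ^ (m mod n)"
        unfolding power_mult[symmetric] power_add[symmetric] by simp
      then show ?thesis using that by (simp add: unity_roots_def)
    qed
    then show ?thesis using \<open>[r * s = 1] (mod n)\<close> by (metis cong_def power_one_right)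
  qed
  have "inj_on (\<lambda>z. z ^ r) (unity_roots n)"
    by (rule inj_on_inverseI[where g = "\<lambda>z. z ^ s"]) (simp add: inv flip: power_mult)
  moreover have "(\<lambda>z. z ^ r) ` unity_roots n \<subseteq> unity_roots n"
    by (auto simp: unity_roots_def) (metis mult.commute power_mult power_one)
  ultimately show ?thesis
    by (simp add: bij_betw_def endo_inj_surj finite_unity_roots assms)
qed

section \<open>The cyclotomic polynomial of a product of three primes\<close>

text \<open>The root with index m is killed by the power p q exactly when r divides m, and similarly
  for the other two pairs. Lying outside all three subgroups thus means that m is coprime to p q
  r.\<close>

lemma cyclotomic_eq_prod:
  fixes p q r :: nat
  assumes "prime p" "prime q" "prime r"
  shows "cyclotomic (p * q * r) = (\<Prod>z\<in>unity_roots (p * q * r) -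
    (unity_roots (p * q) \<union> unity_roots (p * r) \<union> unity_roots (q * r)). [:- z, 1:])"
proof -
  let ?n = "p * q * r"
  define e where "e = (\<lambda>m. exp (2 * of_real pi * \<i> * of_nat m / of_nat ?n))"
  have pos: "p > 0" "q > 0" "r > 0" using assms by (auto simp: prime_gt_0_nat)
  then have n1: "1 \<le> ?n" by (simp add: Suc_leI)
  have pow: "e m ^ k = 1 \<longleftrightarrow> ?n dvd m * k" for m k
  proof -
    have "e m ^ k = e (m * k)" by (simp add: e_def exp_of_nat_mult[symmetric] mult_ac)
    then show ?thesis by (simp only: e_def complex_root_unity_eq_1[OF n1])
  qed
  have cop: "coprime m ?n \<longleftrightarrow> \<not> p dvd m \<and> \<not> q dvd m \<and> \<not> r dvd m" for m
  proof -
    have "coprime m s \<longleftrightarrow> \<not> s dvd m" if "prime s" for s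
      using that by (metis coprime_absorb_right coprime_commute not_prime_unit prime_imp_coprime_nat)
    then show ?thesis using assms by simp
  qed
  have mem: "e m \<in> unity_roots ?n - (unity_roots (p * q) \<union> unity_roots (p * r) \<union> unity_roots (q * r))
      \<longleftrightarrow> coprime m ?n" for m
  proof -
    have dvd: "?n dvd m * (p * q) \<longleftrightarrow> r dvd m" "?n dvd m * (p * r) \<longleftrightarrow> q dvd m" "?n dvd m * (q * r) \<longleftrightarrow> p dvd m"
      using pos dvd_times_right_cancel_iff[of "p * q" r m] dvd_times_right_cancel_iff[of "p * r" q m]
        dvd_times_right_cancel_iff[of "q * r" p m] by (simp_all add: mult_ac)
    then show ?thesis by (simp only: unity_roots_def cop pow Diff_iff Un_iff mem_Collect_eq) auto
  qed
  have inj: "inj_on e {1..?n}"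
  proof (rule inj_onI)
    fix i j assume ij: "i \<in> {1..?n}" "j \<in> {1..?n}" "e i = e j"
    then have "i mod ?n = j mod ?n"
      using complex_root_unity_eq[OF n1, of i j] by (simp add: e_def unique_euclidean_semiring_class.cong_def)
    \<comment> \<open>Indices run from 1 to n, so the residue 0 is represented by n itself; hence
      the case split.\<close>
    with ij(1,2) show "i = j"
      by (cases "i = ?n"; cases "j = ?n") auto
  qed
  \<comment> \<open>By injectivity the image already has n elements, as many as there are n-th roots
    of unity.\<close>
  have onto: "unity_roots ?n \<subseteq> e ` {1..?n}"
  proof -
    have "e ` {1..?n} \<subseteq> unity_roots ?n" unfolding unity_roots_def using pow by auto
    moreover have "card (e ` {1..?n}) = ?n" using card_image[OF inj] by simp
    ultimately show ?thesis
      using card_subset_eq[OF finite_unity_roots, of ?n "e ` {1..?n}"] card_unity_roots[of ?n] n1 by simp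
  qed
  have "bij_betw e {m. 1 \<le> m \<and> m \<le> ?n \<and> coprime m ?n} (unity_roots ?n -
    (unity_roots (p * q) \<union> unity_roots (p * r) \<union> unity_roots (q * r)))"
    unfolding bij_betw_def
  proof
    show "inj_on e {m. 1 \<le> m \<and> m \<le> ?n \<and> coprime m ?n}"
      by (rule inj_on_subset[OF inj]) auto
    show "e ` {m. 1 \<le> m \<and> m \<le> ?n \<and> coprime m ?n} = unity_roots ?n -
      (unity_roots (p * q) \<union> unity_roots (p * r) \<union> unity_roots (q * r))" (is "_ = ?S")
    proof
      show "e ` {m. 1 \<le> m \<and> m \<le> ?n \<and> coprime m ?n} \<subseteq> ?S" using mem by blast
      show "?S \<subseteq> e ` {m. 1 \<le> m \<and> m \<le> ?n \<and> coprime m ?n}"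
      proof
        fix z assume z: "z \<in> ?S"
        then obtain m where "m \<in> {1..?n}" "z = e m" using onto by blast
        with z mem show "z \<in> e ` {m. 1 \<le> m \<and> m \<le> ?n \<and> coprime m ?n}" by auto
      qed
    qed
  qed
  from prod.reindex_bij_betw[OF this, of "\<lambda>z. [:- z, 1:]"] show ?thesis
    unfolding cyclotomic_def e_def by simp
qed

text \<open>With this sign, multiplication by the binomial is a backward difference of coefficients,
  and \<open>n = 1\<close> gives the factor 1 - x that turns coefficients into jumps.\<close>

definition one_minus_X_pow :: "nat \<Rightarrow> complex poly" where
  "one_minus_X_pow n = 1 - monom 1 n"

lemma one_minus_X_pow_0_iff: "one_minus_X_pow n = 0 \<longleftrightarrow> n = 0"
proof
  assume "one_minus_X_pow n = 0"
  then have "monom 1 n = (monom 1 0 :: complex poly)" by (simp add: one_minus_X_pow_def)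
  then show "n = 0" by (metis degree_monom_eq one_neq_zero)
qed (simp add: one_minus_X_pow_def)

lemma poly_one_minus_X_pow [simp]: "poly (one_minus_X_pow n) z = 1 - z ^ n"
  by (simp add: one_minus_X_pow_def poly_monom)

lemma one_minus_X_pow_mult:
  "one_minus_X_pow (a * b) = one_minus_X_pow a * (\<Sum>i<b. monom 1 (a * i))"
  using one_diff_power_eq[of "monom 1 a :: complex poly" b]
  by (simp add: one_minus_X_pow_def monom_power mult.commute)

text \<open>Multiplicative inclusion-exclusion, stated without division so that it applies to
  polynomials.\<close>

lemma prod_Un3:
  fixes g :: "'a \<Rightarrow> 'b :: comm_monoid_mult"
  assumes "finite A" "finite B" "finite C"
  shows "prod g (A \<union> B \<union> C) * prod g (A \<inter> B) * prod g (A \<inter> C) * prod g (B \<inter> C)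
    = prod g A * prod g B * prod g C * prod g (A \<inter> B \<inter> C)"
proof -
  have "prod g ((A \<union> B) \<union> C) * prod g ((A \<union> B) \<inter> C) = prod g (A \<union> B) * prod g C"
    using assms by (simp add: prod.union_inter)
  moreover have "prod g A * prod g B = prod g (A \<union> B) * prod g (A \<inter> B)"
    using assms by (simp add: prod.union_inter)
  moreover have "prod g ((A \<union> B) \<inter> C) * prod g (A \<inter> B \<inter> C) = prod g (A \<inter> C) * prod g (B \<inter> C)"
  proof -
    have "(A \<union> B) \<inter> C = (A \<inter> C) \<union> (B \<inter> C)" "A \<inter> B \<inter> C = (A \<inter> C) \<inter> (B \<inter> C)" by auto
    then show ?thesis using assms by (simp add: prod.union_inter)
  qed
  ultimately have "prod g (A \<union> B \<union> C) * prod g (A \<inter> B) * (prod g (A \<inter> C) * prod g (B \<inter> C))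
      = (prod g A * prod g B) * prod g C * prod g (A \<inter> B \<inter> C)"
    using mult.assoc mult.commute by (smt (verit, best))
  then show ?thesis by (simp add: mult.assoc)
qed

text \<open>Inclusion-exclusion for the subgroups of orders p q, p r, q r: they meet pairwise in
  those of orders p, q, r, and all three meet in {1}, which accounts for the factor 1 - x.\<close>

lemma cyclotomic_identity:
  fixes p q r :: nat
  assumes "prime p" "prime q" "prime r" "p \<noteq> q" "p \<noteq> r" "q \<noteq> r"
  shows "one_minus_X_pow 1 * cyclotomic (p * q * r) *
      (one_minus_X_pow (p * q) * one_minus_X_pow (p * r) * one_minus_X_pow (q * r))
    = one_minus_X_pow (p * q * r) * one_minus_X_pow p * one_minus_X_pow q * one_minus_X_pow r"
proof -
  let ?n = "p * q * r"
  let ?R = unity_roots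
  let ?U = "?R (p * q) \<union> ?R (p * r) \<union> ?R (q * r)"
  define g where "g = (\<lambda>S. \<Prod>z\<in>S. [:- z, 1 :: complex:])"
  have pos: "p > 0" "q > 0" "r > 0" using assms by (auto simp: prime_gt_0_nat)
  have cop: "coprime p q" "coprime p r" "coprime q r"
    using assms by (auto simp: primes_coprime)
  have g: "g (?R k) = - one_minus_X_pow k" if "k > 0" for k
    using prod_unity_roots[OF that] by (simp add: g_def one_minus_X_pow_def)
  have I: "?R (p * q) \<inter> ?R (p * r) = ?R p" "?R (p * q) \<inter> ?R (q * r) = ?R q"
     "?R (p * r) \<inter> ?R (q * r) = ?R r" "?R p \<inter> ?R (q * r) = ?R 1"
  proof -
    have "gcd (p * q) (p * r) = p" "gcd (p * q) (q * r) = q" "gcd (p * r) (q * r) = r"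
      using cop gcd_mult_distrib_nat[of p q r] gcd_mult_distrib_nat[of q p r] gcd_mult_distrib_nat[of r p q]
      by (simp_all add: mult.commute)
    then show "?R (p * q) \<inter> ?R (p * r) = ?R p" "?R (p * q) \<inter> ?R (q * r) = ?R q"
     "?R (p * r) \<inter> ?R (q * r) = ?R r" by (simp_all add: unity_roots_Int)
    show "?R p \<inter> ?R (q * r) = ?R 1" using cop by (simp add: unity_roots_Int)
  qed
  have sub: "?U \<subseteq> ?R ?n"
    by (auto simp: unity_roots_def) (metis mult.assoc mult.commute power_mult power_one)+
  have "g (?R ?n) = g (?R ?n - ?U) * g ?U"
    unfolding g_def by (rule prod.subset_diff[OF sub]) (use pos in \<open>simp add: finite_unity_roots\<close>)
  moreover have "g (?R ?n - ?U) = cyclotomic ?n"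
    unfolding g_def using cyclotomic_eq_prod[OF assms(1-3)] by simp
  moreover have "g ?U * g (?R p) * g (?R q) * g (?R r)
      = g (?R (p * q)) * g (?R (p * r)) * g (?R (q * r)) * g (?R 1)"
    using prod_Un3[of "?R (p * q)" "?R (p * r)" "?R (q * r)" "\<lambda>z. [:- z, 1 :: complex:]"] pos
    by (simp only: I g_def finite_unity_roots nat_0_less_mult_iff)
  ultimately have "g (?R ?n) * g (?R p) * g (?R q) * g (?R r) =
      cyclotomic ?n * (g (?R (p * q)) * g (?R (p * r)) * g (?R (q * r)) * g (?R 1))"
    by (metis (no_types, lifting) mult.assoc)
  \<comment> \<open>Each side has four factors of the form \<open>g (?R k)\<close>, so the minus
    signs from \<open>g\<close> cancel.\<close>
  then show ?thesis using pos by (simp add: g mult_ac)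
qed

section \<open>The coefficients of \<open>(1 - x) \<Phi>\<^sub>n\<close>\<close>

text \<open>Integer indices let a shift run below 0 without a side condition.\<close>

definition int_coeff :: "complex poly \<Rightarrow> int \<Rightarrow> complex" where
  "int_coeff f k = (if k < 0 then 0 else coeff f (nat k))"

lemma int_coeff_one_minus_X_pow_mult:
  "int_coeff (one_minus_X_pow a * f) k = int_coeff f k - int_coeff f (k - int a)"
proof -
  have "one_minus_X_pow a * f = f - monom 1 a * f"
    by (simp add: one_minus_X_pow_def left_diff_distrib)
  then show ?thesis
    by (auto simp: int_coeff_def coeff_monom_mult nat_diff_distrib le_nat_iff)
qed

section \<open>The box polynomial and its coefficients\<close>

text \<open>The coefficient at j counts the representations j = a q r + b p r + c p q within the
  box. As a product of three geometric sums, this is (1 - X^n)^3 divided by the binomials with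
  exponents q r, p r and p q, where n = p q r.\<close>

definition box_poly :: "nat \<Rightarrow> nat \<Rightarrow> nat \<Rightarrow> complex poly" where
  "box_poly p q r = (\<Sum>(a, b, c)\<in>{..<p} \<times> {..<q} \<times> {..<r}.
    monom 1 (a * (q * r) + b * (p * r) + c * (p * q)))"

lemma box_poly_eq:
  "box_poly p q r = (\<Sum>a<p. monom 1 (q * r * a)) *
    ((\<Sum>b<q. monom 1 (p * r * b)) * (\<Sum>c<r. monom 1 (p * q * c)))"
  unfolding sum_product unfolding sum_distrib_left
  by (simp add: box_poly_def sum.cartesian_product[symmetric] mult_monom mult_ac add_ac)

text \<open>This is \<open>cyclotomic_identity\<close> with its denominators cleared. The two
  factors 1 - X^n on the left do not affect coefficients below n.\<close>

lemma cyclotomic_box_poly: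
  fixes p q r :: nat
  assumes "prime p" "prime q" "prime r" "p \<noteq> q" "p \<noteq> r" "q \<noteq> r"
  shows "one_minus_X_pow (p * q * r) * (one_minus_X_pow (p * q * r) * (one_minus_X_pow 1 * cyclotomic (p * q * r)))
    = one_minus_X_pow r * (one_minus_X_pow q * (one_minus_X_pow p * box_poly p q r))"
proof -
  let ?V = one_minus_X_pow
  let ?n = "p * q * r"
  let ?f = "?V 1 * cyclotomic ?n"
  define A B C where "A = (\<Sum>a<p. monom (1 :: complex) (q * r * a))"
    and "B = (\<Sum>b<q. monom (1 :: complex) (p * r * b))"
    and "C = (\<Sum>c<r. monom (1 :: complex) (p * q * c))"
  have V: "?V ?n = ?V (q * r) * A" "?V ?n = ?V (p * r) * B" "?V ?n = ?V (p * q) * C"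
    using one_minus_X_pow_mult[of "q * r" p] one_minus_X_pow_mult[of "p * r" q]
      one_minus_X_pow_mult[of "p * q" r] by (simp_all add: A_def B_def C_def mult_ac)
  \<comment> \<open>Each of the three copies of \<open>?V ?n\<close> is expanded by a different
    factorization.\<close>
  have "?V ?n * (?V ?n * (?V ?n * ?f)) = ?f * (?V (p * q) * ?V (p * r) * ?V (q * r)) * (A * B * C)"
    by (subst (1) V(1), subst (1) V(2), subst (1) V(3)) (simp only: mult_ac)
  also have "\<dots> = ?V ?n * ?V p * ?V q * ?V r * (A * B * C)"
    by (simp only: cyclotomic_identity[OF assms])
  finally have "?V ?n * (?V ?n * (?V ?n * ?f)) = ?V ?n * (?V r * (?V q * (?V p * (A * B * C))))"
    by (simp only: mult_ac)
  moreover have "?V ?n \<noteq> 0" using assms by (auto simp: one_minus_X_pow_0_iff)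
  ultimately show ?thesis by (simp add: box_poly_eq A_def B_def C_def mult.assoc)
qed

text \<open>\<open>b\<close> and \<open>c\<close> are the only exponents compatible with \<open>j\<close> modulo \<open>q\<close> and \<open>r\<close>; since
  \<open>j < p q r\<close>, the third exponent is automatically less than \<open>p\<close>.\<close>

lemma int_coeff_box_poly:
  fixes p q r :: nat and j b c :: int
  assumes cop: "coprime p q" "coprime p r" "coprime q r"
    and pos: "p > 0" "q > 0" "r > 0"
    and b: "0 \<le> b" "b < q" "q dvd j - p * r * b"
    and c: "0 \<le> c" "c < r" "r dvd j - p * q * c"
    and j: "j < p * q * r"
  shows "int_coeff (box_poly p q r) j = of_bool (p * (b * r + c * q) \<le> j)"
proof (cases "j < 0")
  case True
  have "p * (b * r + c * q) \<ge> 0" using b c by simp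
  with True show ?thesis by (simp add: int_coeff_def)
next
  case False
  let ?e = "\<lambda>(x, y, z). x * (q * r) + y * (p * r) + z * (p * q)"
  let ?box = "{..<p} \<times> {..<q} \<times> {..<r}"
  define S where "S = {t \<in> ?box. ?e t = nat j}"
  have "int_coeff (box_poly p q r) j = (\<Sum>t\<in>?box. if ?e t = nat j then 1 else 0)"
    using False by (simp add: int_coeff_def box_poly_def coeff_sum case_prod_unfold)
  also have "\<dots> = of_nat (card S)"
    by (simp add: S_def sum.If_cases Int_def)
  finally have card: "int_coeff (box_poly p q r) j = of_nat (card S)" .
  have S: "(x, y, z) \<in> S \<longleftrightarrow> x < p \<and> int y = b \<and> int z = c \<and> x * (q * r) = j - p * (b * r + c * q)"
    for x y z
  proof
    assume "(x, y, z) \<in> S"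
    then have xyz: "x < p" "y < q" "z < r"
      and "int (x * (q * r) + y * (p * r) + z * (p * q)) = j"
      using False by (auto simp: S_def)
    then have e: "j = x * (q * r) + y * (p * r) + z * (p * q)" by simp
    have "int q dvd (p * r) * (int y - b)"
    proof -
      have "(p * r) * (int y - b) = (j - p * r * b) - q * (x * r + z * p)"
        using e by (simp add: algebra_simps)
      then show ?thesis using b(3) by (metis dvd_diff dvd_triv_left of_nat_mult)
    qed
    moreover have "coprime (int q) (p * r)"
      using cop by (simp add: coprime_commute)
    ultimately have "int q dvd int y - b" using coprime_dvd_mult_right_iff by blast
    then have y: "int y = b"
      using xyz(2) b(1,2) by (metis mod_eq_dvd_iff mod_pos_pos_trivial of_nat_0_le_iff of_nat_less_iff)
    have "int r dvd (p * q) * (int z - c)"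
    proof -
      have "(p * q) * (int z - c) = (j - p * q * c) - r * (x * q + y * p)"
        using e by (simp add: algebra_simps)
      then show ?thesis using c(3) by (metis dvd_diff dvd_triv_left of_nat_mult)
    qed
    moreover have "coprime (int r) (p * q)"
      using cop by (simp add: coprime_commute)
    ultimately have "int r dvd int z - c" using coprime_dvd_mult_right_iff by blast
    then have z: "int z = c"
      using xyz(3) c(1,2) by (metis mod_eq_dvd_iff mod_pos_pos_trivial of_nat_0_le_iff of_nat_less_iff)
    show "x < p \<and> int y = b \<and> int z = c \<and> x * (q * r) = j - p * (b * r + c * q)"
      using xyz e by (simp add: y z algebra_simps)
  next
    assume a: "x < p \<and> int y = b \<and> int z = c \<and> x * (q * r) = j - p * (b * r + c * q)"
    then have "int (x * (q * r) + y * (p * r) + z * (p * q)) = j"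
      by (simp add: algebra_simps)
    then have "x * (q * r) + y * (p * r) + z * (p * q) = nat j" by linarith
    then show "(x, y, z) \<in> S" using a b(2) c(2) by (auto simp: S_def)
  qed
  show ?thesis
  proof (cases "p * (b * r + c * q) \<le> j")
    case True
    let ?d = "j - p * (b * r + c * q)"
    have "?d = (j - p * r * b) - q * (p * c)" "?d = (j - p * q * c) - r * (p * b)"
      by (simp_all add: algebra_simps)
    then have "int q dvd ?d" "int r dvd ?d" using b(3) c(3) by (metis dvd_diff dvd_triv_left of_nat_mult)+
    then have "int (q * r) dvd ?d" using cop(3) by (simp add: divides_mult)
    then obtain x where x: "?d = int (q * r) * x" by (auto elim: dvdE)
    have "0 \<le> int (q * r) * x" using True x by linarith
    moreover have "0 < int (q * r)" using pos by simp
    ultimately have x0: "0 \<le> x" by (meson linorder_not_le mult_pos_neg)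
    have "int (q * r) * x < int (q * r) * p"
    proof -
      have "p * (b * r + c * q) \<ge> 0" using b c by simp
      then show ?thesis using x j by (simp add: mult_ac)
    qed
    then have "x < p" using pos by (simp add: mult_less_cancel_left)
    then have "(nat x, nat b, nat c) \<in> S"
      unfolding S using x x0 b c by (simp add: mult_ac)
    moreover have "t = (nat x, nat b, nat c)" if "t \<in> S" for t
    proof -
      obtain x' y z where t: "t = (x', y, z)" by (cases t)
      with that S have "int y = b" "int z = c" "x' * (q * r) = ?d" by auto
      then have "int (q * r) * int x' = int (q * r) * x" using x by (simp add: mult_ac)
      then have "int x' = x" using pos by simp
      with t \<open>int y = b\<close> \<open>int z = c\<close> show ?thesis by auto
    qed
    ultimately have "S = {(nat x, nat b, nat c)}" by blast
    then show ?thesis using card True by simp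
  next
    case F: False
    have "S = {}"
    proof (rule ccontr)
      assume "S \<noteq> {}"
      then obtain x y z where "(x, y, z) \<in> S" by (metis ex_in_conv prod_cases3)
      with S have "int (x * (q * r)) = j - p * (b * r + c * q)" by blast
      then show False using F by (smt (verit) of_nat_0_le_iff)
    qed
    then show ?thesis using card F by simp
  qed
qed

section \<open>Differences of the box coefficients\<close>

lemma residue_exists:
  fixes a m k :: int
  assumes "coprime a m" "m > 0"
  obtains b where "0 \<le> b" "b < m" "m dvd k - a * b"
proof -
  obtain x where x: "[a * x = 1] (mod m)" using cong_solve_coprime_int[OF assms(1)] by blast
  have "[a * (x * k mod m) = a * (x * k)] (mod m)" by (simp add: cong_def mod_mult_right_eq)
  also have "[a * (x * k) = 1 * k] (mod m)" using cong_scalar_right[OF x, of k] by (simp add: mult.assoc)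
  finally have "m dvd k - a * (x * k mod m)" by (simp add: cong_iff_dvd_diff dvd_diff_commute)
  then show thesis using that[of "x * k mod m"] assms(2) by simp
qed

text \<open>\<open>l\<close> inverts \<open>r\<close> modulo \<open>q\<close> and \<open>m\<close>
  inverts \<open>q\<close> modulo \<open>r\<close>. They describe how the exponents \<open>b\<close>
  and \<open>c\<close> of the box move when \<open>j\<close> drops by \<open>p\<close>.\<close>

lemma bezout_positive:
  fixes q r :: int
  assumes "coprime q r" "1 < q" "1 < r"
  obtains l m where "0 < l" "l < q" "0 < m" "m < r" "l * r + m * q = 1 + q * r"
proof -
  obtain l where l: "0 \<le> l" "l < q" "q dvd 1 - r * l"
    using residue_exists[of r q 1] assms by (auto simp: coprime_commute)
  have "l \<noteq> 0" using l assms by auto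
  then have l0: "0 < l" using l by simp
  \<comment> \<open>Adding \<open>q * r\<close> preserves divisibility and makes the cofactor
    \<open>m\<close> positive, because \<open>l\<close> is at most \<open>q - 1\<close>.\<close>
  have "q dvd (1 - r * l) + q * r" using l(3) by simp
  then obtain m where m: "(1 - r * l) + q * r = q * m" by (elim dvdE)
  then have e: "l * r + m * q = 1 + q * r" by (simp add: algebra_simps)
  have "r * l \<le> r * (q - 1)" using l assms by (intro mult_left_mono) auto
  then have "0 < q * m" using m assms by (simp add: algebra_simps)
  then have m0: "0 < m" using assms by (simp add: zero_less_mult_iff)
  have "r * 1 \<le> r * l" using l0 assms by (intro mult_left_mono) auto
  then have "q * m < q * r" using m assms by linarith
  then have "m < r" using assms(2) by (metis mult_less_cancel_left_pos zero_less_one order_less_trans)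
  then show thesis using that l0 l(2) m0 e by blast
qed

text \<open>Reading \<open>u\<close> and \<open>v\<close> as 0 or 1, without the conditions on \<open>s\<close> the value would be
  \<open>u + v - 1\<close>, whose mixed differences vanish.\<close>

definition threshold_term :: "int \<Rightarrow> bool \<Rightarrow> bool \<Rightarrow> int \<Rightarrow> complex" where
  "threshold_term n u v s =
    (if u \<and> v then of_bool (s \<le> 0) else if \<not> u \<and> \<not> v then - of_bool (s \<le> n) else 0)"

text \<open>Unless all four flags agree, at most two terms can be nonzero, and these contribute with
  opposite signs. If they agree, there is one common threshold; the values 2 and -2 are excluded
  because (x0 + y0) + (x1 + y1) = (x0 + y1) + (x1 + y0).\<close>

lemma threshold_term_mixed_difference:
  "threshold_term n u0 v0 (x0 + y0) - threshold_term n u0 v1 (x0 + y1)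
    - threshold_term n u1 v0 (x1 + y0) + threshold_term n u1 v1 (x1 + y1) \<in> {-1, 0, 1}"
  unfolding threshold_term_def by (cases u0; cases u1; cases v0; cases v1) (auto simp: of_bool_def)

text \<open>Passing from j to j - p replaces \<open>b\<close> by \<open>b - l\<close> modulo
  \<open>q\<close> and \<open>c\<close> by \<open>c - m\<close> modulo \<open>r\<close>. The flags
  record which of the two wraps around, and each wrap adds p q r to the sum compared with j -
  p.\<close>

lemma int_coeff_box_poly_diff:
  fixes p q r :: nat and j b c l m :: int
  assumes cop: "coprime p q" "coprime p r" "coprime q r"
    and pos: "p > 0" "q > 0" "r > 0"
    and b: "0 \<le> b" "b < q" "q dvd j - p * r * b"
    and c: "0 \<le> c" "c < r" "r dvd j - p * q * c"
    and j: "j < p * q * r"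
    and lm: "0 < l" "l < q" "0 < m" "m < r" "l * r + m * q = 1 + q * r"
  shows "int_coeff (box_poly p q r) j - int_coeff (box_poly p q r) (j - p) =
    threshold_term (p * q * r) (b < l) (c < m) (p * r * b + p * q * c - j)"
proof -
  define b' where "b' = (if b < l then b - l + q else b - l)"
  define c' where "c' = (if c < m then c - m + r else c - m)"
  have b'r: "0 \<le> b'" "b' < q" and c'r: "0 \<le> c'" "c' < r"
    using b c lm by (auto simp: b'_def c'_def)
  have lr: "l * r = 1 + q * (r - m)" and mq: "m * q = 1 + r * (q - l)"
    using lm(5) by (simp_all add: algebra_simps)
  have "int q dvd (j - p * r * b) + q * (p * (r - m)) - (if b < l then q * (p * r) else 0)"
    using b(3) by (auto intro!: dvd_add dvd_diff)
  also have "(j - p * r * b) + q * (p * (r - m)) - (if b < l then q * (p * r) else 0) = (j - p) - p * r * b'"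
  proof -
    have "p * r * b' = p * r * b - p * (l * r) + (if b < l then q * (p * r) else 0)"
      by (simp add: b'_def algebra_simps)
    then show ?thesis unfolding lr by (simp add: algebra_simps)
  qed
  finally have b'd: "int q dvd (j - p) - p * r * b'" .
  have "int r dvd (j - p * q * c) + r * (p * (q - l)) - (if c < m then r * (p * q) else 0)"
    using c(3) by (auto intro!: dvd_add dvd_diff)
  also have "(j - p * q * c) + r * (p * (q - l)) - (if c < m then r * (p * q) else 0) = (j - p) - p * q * c'"
  proof -
    have "p * q * c' = p * q * c - p * (m * q) + (if c < m then r * (p * q) else 0)"
      by (simp add: c'_def algebra_simps)
    then show ?thesis unfolding mq by (simp add: algebra_simps)
  qed
  finally have c'd: "int r dvd (j - p) - p * q * c'" .
  have P: "int_coeff (box_poly p q r) j = of_bool (p * (b * r + c * q) \<le> j)"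
    by (rule int_coeff_box_poly[OF cop pos b c j])
  have P': "int_coeff (box_poly p q r) (j - p) = of_bool (p * (b' * r + c' * q) \<le> j - p)"
    by (rule int_coeff_box_poly[OF cop pos b'r b'd c'r c'd]) (use j in simp)
  let ?s = "p * r * b + p * q * c"
  let ?n = "int p * q * r"
  have s: "p * (b * r + c * q) = ?s" by (simp add: algebra_simps)
  have s': "p * (b' * r + c' * q) = ?s - p - ?n + (if b < l then ?n else 0) + (if c < m then ?n else 0)"
  proof -
    have "p * (b' * r + c' * q) = ?s - p * (l * r + m * q) + (if b < l then ?n else 0) + (if c < m then ?n else 0)"
      by (simp add: b'_def c'_def algebra_simps)
    then show ?thesis unfolding lm(5) by (simp add: algebra_simps)
  qed
  \<comment> \<open>These bounds each settle one indicator. If both exponents wrap, the second would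
    need \<open>?s\<close> to be at most j - n, which is negative; if neither wraps, the first fails
    since \<open>?s\<close> is at least p + n. With a single wrap the two indicators
    coincide.\<close>
  have s0: "?s \<ge> 0" using b c by simp
  have big: "?s \<ge> p + ?n" if "\<not> b < l" "\<not> c < m"
  proof -
    have "p * (l * r + m * q) \<le> p * (b * r + c * q)"
      using that by (intro mult_left_mono add_mono mult_right_mono) auto
    then show ?thesis unfolding lm(5) s by (simp add: algebra_simps)
  qed
  have j': "j < ?n" using j by simp
  show ?thesis
    unfolding P P' s s' using s0 big j' pos
    by (cases "b < l"; cases "c < m") (auto simp: threshold_term_def of_bool_def)
qed

text \<open>The coefficient is an iterated difference of box coefficients with steps p, q, r. The
  step p yields a \<open>threshold_term\<close>, and the steps q and r form its mixed
  difference.\<close>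

lemma int_coeff_cyclotomic:
  fixes p q r :: nat and k :: int
  assumes pr: "prime p" "prime q" "prime r" "p \<noteq> q" "p \<noteq> r" "q \<noteq> r"
    and k: "k < p * q * r"
  shows "int_coeff (one_minus_X_pow 1 * cyclotomic (p * q * r)) k \<in> {-1, 0, 1}"
proof -
  let ?n = "p * q * r"
  let ?f = "one_minus_X_pow 1 * cyclotomic ?n"
  define P where "P = int_coeff (box_poly p q r)"
  define h where "h = (\<lambda>j. P j - P (j - p))"
  have pos: "p > 0" "q > 0" "r > 0" using pr by (auto simp: prime_gt_0_nat)
  have gt1: "int q > 1" "int r > 1" using prime_gt_1_nat[OF pr(2)] prime_gt_1_nat[OF pr(3)] by simp_all
  have cop: "coprime p q" "coprime p r" "coprime q r"
    using pr by (auto simp: primes_coprime)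
  have icop: "coprime (int p * r) q" "coprime (int p * q) r" "coprime (int q) r"
    using cop by (auto simp: coprime_commute)
  \<comment> \<open>As k < n, every shift by n lands on a negative index, where
    \<open>int_coeff\<close> is 0.\<close>
  have "int_coeff ?f k = int_coeff (one_minus_X_pow ?n * (one_minus_X_pow ?n * ?f)) k"
  proof -
    have "k - int ?n < 0" "k - int ?n - int ?n < 0" using k by linarith+
    then show ?thesis
      unfolding int_coeff_one_minus_X_pow_mult[of ?n] by (simp only: int_coeff_def if_True diff_zero)
  qed
  also have "\<dots> = h k - h (k - q) - h (k - r) + h (k - q - r)"
    unfolding cyclotomic_box_poly[OF pr] int_coeff_one_minus_X_pow_mult h_def P_def
    by (simp add: algebra_simps)
  finally have fk: "int_coeff ?f k = h k - h (k - q) - h (k - r) + h (k - q - r)" .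
  obtain l m where lm: "0 < l" "l < int q" "0 < m" "m < int r" "l * r + m * q = 1 + int q * r"
    using bezout_positive[OF icop(3) gt1] by metis
  then have bez: "l * r + m * q = int (1 + q * r)" by simp
  have h: "h j = threshold_term (p * q * r) (b < l) (c < m) (p * r * b + p * q * c - j)"
    if "0 \<le> b" "b < q" "q dvd j - p * r * b" "0 \<le> c" "c < r" "r dvd j - p * q * c" "j \<le> k" for j b c :: int
    unfolding h_def P_def
    by (rule int_coeff_box_poly_diff[OF cop pos that(1-6) _ lm(1-4) bez]) (use k that(7) in simp)
  have "\<exists>b :: int. 0 \<le> b \<and> b < int q \<and> int q dvd j - p * r * b" for j :: int
    by (rule residue_exists[of "int (p * r)" "int q" j]) (use icop pos in auto)
  then obtain b0 b1 :: int where b0: "0 \<le> b0" "b0 < int q" "int q dvd k - p * r * b0"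
    and b1: "0 \<le> b1" "b1 < int q" "int q dvd (k - r) - p * r * b1" by meson
  have "\<exists>c :: int. 0 \<le> c \<and> c < int r \<and> int r dvd j - p * q * c" for j :: int
    by (rule residue_exists[of "int (p * q)" "int r" j]) (use icop pos in auto)
  then obtain c0 c1 :: int where c0: "0 \<le> c0" "c0 < int r" "int r dvd k - p * q * c0"
    and c1: "0 \<le> c1" "c1 < int r" "int r dvd (k - q) - p * q * c1" by meson
  have b0': "int q dvd (k - q) - p * r * b0" and b1': "int q dvd (k - q - r) - p * r * b1"
    using dvd_diff[OF b0(3) dvd_refl] dvd_diff[OF b1(3) dvd_refl]
    by (simp_all only: diff_diff_add add_ac)
  have c0': "int r dvd (k - r) - p * q * c0" and c1': "int r dvd (k - q - r) - p * q * c1"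
    using dvd_diff[OF c0(3) dvd_refl] dvd_diff[OF c1(3) dvd_refl]
    by (simp_all only: diff_diff_add add_ac)
  note hs = h[OF b0 c0] h[OF b0(1,2) b0' c1] h[OF b1 c0(1,2) c0'] h[OF b1(1,2) b1' c1(1,2) c1']
  \<comment> \<open>The arguments are brought into the form x + y, where x changes only with the
    shift by r and y only with the shift by q.\<close>
  have s: "p * r * b0 + p * q * c0 - k = (p * r * b0 - k) + p * q * c0"
    "p * r * b0 + p * q * c1 - (k - q) = (p * r * b0 - k) + (p * q * c1 + q)"
    "p * r * b1 + p * q * c0 - (k - r) = (p * r * b1 + r - k) + p * q * c0"
    "p * r * b1 + p * q * c1 - (k - q - r) = (p * r * b1 + r - k) + (p * q * c1 + q)"
    by simp_all
  \<comment> \<open>\<open>b\<close> depends only on the shift by \<open>r\<close> and \<open>c\<close> only on the shift by \<open>q\<close>, which makes \<open>h k - h (k - q) - \<dots>\<close>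
    a mixed difference.\<close>
  show ?thesis
    unfolding fk using threshold_term_mixed_difference by (simp only: hs s)
qed

section \<open>Mean squares over roots of unity\<close>

text \<open>If n does not divide m, rotating by a primitive root \<open>w\<close> multiplies the sum
  by \<open>w ^ m\<close>, which is not 1, so the sum vanishes.\<close>

lemma sum_power_unity_roots:
  assumes "n > 0"
  shows "(\<Sum>z\<in>unity_roots n. z ^ m) = (if n dvd m then of_nat n else 0)"
proof (cases "n dvd m")
  case True
  then have "z ^ m = 1" if "z \<in> unity_roots n" for z
    using that by (auto simp: unity_roots_def power_mult elim!: dvdE)
  then have "(\<Sum>z\<in>unity_roots n. z ^ m) = (\<Sum>z\<in>unity_roots n. 1)" by (intro sum.cong) auto
  then show ?thesis using True card_unity_roots[OF assms] by simp
next
  case False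
  define w where "w = exp (2 * of_real pi * \<i> * of_nat 1 / of_nat n)"
  have w: "w ^ k = 1 \<longleftrightarrow> n dvd k" for k
  proof -
    have "w ^ k = exp (2 * of_real pi * \<i> * of_nat k / of_nat n)"
      by (simp add: w_def exp_of_nat_mult[symmetric] mult_ac)
    then show ?thesis using assms by (simp only: complex_root_unity_eq_1 Suc_leI One_nat_def)
  qed
  have "w ^ n = 1" "w \<noteq> 0" using w by (auto simp: w_def)
  then have bij: "bij_betw (\<lambda>z. w * z) (unity_roots n) (unity_roots n)"
    by (intro bij_betw_byWitness[where f' = "\<lambda>z. z / w"])
      (auto simp: unity_roots_def power_mult_distrib power_divide)
  have "(\<Sum>z\<in>unity_roots n. z ^ m) = (\<Sum>z\<in>unity_roots n. (w * z) ^ m)"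
    using sum.reindex_bij_betw[OF bij, of "\<lambda>z. z ^ m"] by simp
  also have "\<dots> = w ^ m * (\<Sum>z\<in>unity_roots n. z ^ m)"
    by (simp add: power_mult_distrib sum_distrib_left)
  finally have "(1 - w ^ m) * (\<Sum>z\<in>unity_roots n. z ^ m) = 0" by (simp add: left_diff_distrib)
  then show ?thesis using w[of m] False by auto
qed

text \<open>Conjugation inverts on the unit circle; the exponent \<open>n - k\<close> keeps the
  inverse a natural power.\<close>

lemma cnj_unity_root:
  assumes "z \<in> unity_roots n" "k \<le> n"
  shows "cnj (z ^ k) = z ^ (n - k)"
proof (cases "n = 0")
  case False
  have z: "z ^ n = 1" using assms by (simp add: unity_roots_def)
  then have "cmod z ^ n = 1" by (metis norm_one norm_power)
  then have "cmod z = 1" using False power_eq_iff_eq_base[of n "cmod z" 1] by simp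
  then have "z ^ k * cnj (z ^ k) = 1"
    by (simp add: complex_norm_square[symmetric] power_mult_distrib[symmetric] del: complex_cnj_power)
      (simp add: norm_power)
  moreover have "z ^ k * z ^ (n - k) = 1" using z assms(2) by (simp flip: power_add)
  ultimately show ?thesis by (metis mult.left_commute mult.right_neutral)
qed (use assms in simp)

lemma parseval_unity_roots:
  fixes f :: "complex poly"
  assumes "degree f < n"
  shows "(\<Sum>z\<in>unity_roots n. (cmod (poly f z))\<^sup>2) = n * (\<Sum>k<n. (cmod (coeff f k))\<^sup>2)"
proof -
  have n: "n > 0" using assms by simp
  have f: "poly f z = (\<Sum>k<n. coeff f k * z ^ k)" for z
    unfolding poly_altdef using assms
    by (intro sum.mono_neutral_left) (auto simp: coeff_eq_0)
  have "(\<Sum>z\<in>unity_roots n. poly f z * cnj (poly f z))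
      = (\<Sum>z\<in>unity_roots n. \<Sum>k<n. \<Sum>l<n. coeff f k * cnj (coeff f l) * z ^ (k + (n - l)))"
  proof (intro sum.cong refl)
    fix z assume z: "z \<in> unity_roots n"
    have cnj: "cnj (poly f z) = (\<Sum>l<n. cnj (coeff f l) * z ^ (n - l))"
      unfolding f cnj_sum complex_cnj_mult
      by (intro sum.cong refl) (use cnj_unity_root[OF z] in simp)
    then show "poly f z * cnj (poly f z)
      = (\<Sum>k<n. \<Sum>l<n. coeff f k * cnj (coeff f l) * z ^ (k + (n - l)))"
      unfolding cnj unfolding f sum_product by (simp only: power_add mult_ac)
  qed
  also have "\<dots> = (\<Sum>k<n. \<Sum>l<n. coeff f k * cnj (coeff f l) * (\<Sum>z\<in>unity_roots n. z ^ (k + (n - l))))"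
    by (simp add: sum.swap[of _ _ "unity_roots n"] sum_distrib_left)
  also have "\<dots> = (\<Sum>k<n. \<Sum>l<n. if l = k then of_nat n * (coeff f k * cnj (coeff f k)) else 0)"
  proof (intro sum.cong refl)
    fix k l assume kl: "k \<in> {..<n}" "l \<in> {..<n}"
    \<comment> \<open>The exponent lies strictly between 0 and 2 n, so the only possible multiple is
      n itself.\<close>
    have "n dvd k + (n - l) \<longleftrightarrow> l = k"
    proof
      assume "n dvd k + (n - l)"
      then obtain d where d: "k + (n - l) = n * d" by (elim dvdE)
      have "0 < n * d" "n * d < n * 2" unfolding d[symmetric] using kl by auto
      then have "d = 1" by simp
      with d kl show "l = k" by auto
    qed (use kl in auto)
    then show "coeff f k * cnj (coeff f l) * (\<Sum>z\<in>unity_roots n. z ^ (k + (n - l)))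
      = (if l = k then of_nat n * (coeff f k * cnj (coeff f k)) else 0)"
      by (simp add: sum_power_unity_roots[OF n])
  qed
  also have "\<dots> = of_nat n * (\<Sum>k<n. coeff f k * cnj (coeff f k))"
    by (simp add: sum_distrib_left)
  finally have "complex_of_real (\<Sum>z\<in>unity_roots n. (cmod (poly f z))\<^sup>2)
      = complex_of_real (n * (\<Sum>k<n. (cmod (coeff f k))\<^sup>2))"
    by (simp add: complex_norm_square del: of_real_power) 
  then show ?thesis using of_real_eq_iff by blast
qed

section \<open>The contribution of the roots of order p q\<close>

text \<open>AM-GM in logarithmic form: summing ln x <= x - 1 over the squares gives the bound, since
  their product is 1.\<close>

lemma sum_power2_ge_card:
  fixes t :: "'a \<Rightarrow> real"
  assumes "\<And>x. x \<in> S \<Longrightarrow> t x > 0" "prod t S = 1"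
  shows "real (card S) \<le> (\<Sum>x\<in>S. (t x)\<^sup>2)"
proof (cases "finite S")
  case True
  have "0 = ln ((prod t S)\<^sup>2)" by (simp add: assms(2))
  also have "(prod t S)\<^sup>2 = (\<Prod>x\<in>S. (t x)\<^sup>2)" by (simp add: prod_power_distrib)
  also have "ln (\<Prod>x\<in>S. (t x)\<^sup>2) = (\<Sum>x\<in>S. ln ((t x)\<^sup>2))"
    using assms(1) True by (intro ln_prod) force+
  also have "\<dots> \<le> (\<Sum>x\<in>S. (t x)\<^sup>2 - 1)"
    using assms(1) by (intro sum_mono ln_le_minus_one) force
  finally show ?thesis by (simp add: sum_subtractf)
qed (use assms in simp)

text \<open>For distinct primes these are the roots of unity of exact order
  \<open>p * q\<close>.\<close>

definition primitive_roots2 :: "nat \<Rightarrow> nat \<Rightarrow> complex set" where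
  "primitive_roots2 p q = unity_roots (p * q) - (unity_roots p \<union> unity_roots q)"

context
  fixes p q :: nat
  assumes pq: "prime p" "prime q" "p \<noteq> q"
begin

lemma pq_pos: "p > 0" "q > 0" and pq_coprime: "coprime p q"
  using pq by (auto simp: prime_gt_0_nat primes_coprime)

lemma unity_roots_pq: "unity_roots p \<subseteq> unity_roots (p * q)" "unity_roots q \<subseteq> unity_roots (p * q)"
  "unity_roots p \<inter> unity_roots q = {1}"
proof -
  show "unity_roots p \<subseteq> unity_roots (p * q)" "unity_roots q \<subseteq> unity_roots (p * q)"
    by (auto simp: unity_roots_def power_mult) (metis mult.commute power_mult power_one)
  show "unity_roots p \<inter> unity_roots q = {1}"
    using pq_coprime by (simp add: unity_roots_Int) (simp add: unity_roots_def)
qed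

lemma finite_primitive_roots2: "finite (primitive_roots2 p q)"
  using pq_pos by (simp add: primitive_roots2_def finite_unity_roots)

lemma card_primitive_roots2: "card (primitive_roots2 p q) = (p - 1) * (q - 1)"
proof -
  have fin: "finite (unity_roots p)" "finite (unity_roots q)" "finite (unity_roots (p * q))"
    using pq_pos by (auto simp: finite_unity_roots)
  have "card (unity_roots p \<union> unity_roots q) + 1 = p + q"
    using card_Un_Int[OF fin(1,2)] pq_pos by (simp add: unity_roots_pq(3) card_unity_roots)
  moreover have "card (primitive_roots2 p q) = p * q - card (unity_roots p \<union> unity_roots q)"
    unfolding primitive_roots2_def using pq_pos unity_roots_pq fin
    by (subst card_Diff_subset) (auto simp: card_unity_roots)
  ultimately have "card (primitive_roots2 p q) = p * q - (p + q - 1)" by simp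
  then show ?thesis using pq_pos by (simp add: algebra_simps)
qed

text \<open>The products over the nontrivial roots for p q, p and q are p q, p and q, so the
  quotient is 1.\<close>

lemma prod_primitive_roots2: "(\<Prod>z\<in>primitive_roots2 p q. 1 - z) = 1"
proof -
  let ?g = "\<lambda>S. \<Prod>z\<in>S. 1 - z :: complex"
  have g: "?g (unity_roots k - {1}) = of_nat k" if "k > 0" for k
    using prod_one_minus_unity_roots[OF that] .
  have fin: "finite (unity_roots p)" "finite (unity_roots q)" "finite (unity_roots (p * q))"
    using pq_pos by (auto simp: finite_unity_roots)
  have d: "(unity_roots p - {1}) \<inter> (unity_roots q - {1}) = {}"
    "primitive_roots2 p q \<inter> (unity_roots p - {1} \<union> (unity_roots q - {1})) = {}"
    using unity_roots_pq(3) by (auto simp: primitive_roots2_def)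
  have "unity_roots (p * q) - {1} = primitive_roots2 p q \<union> ((unity_roots p - {1}) \<union> (unity_roots q - {1}))"
    using unity_roots_pq by (auto simp: primitive_roots2_def)
  then have "?g (unity_roots (p * q) - {1}) = ?g (primitive_roots2 p q) * (?g (unity_roots p - {1}) * ?g (unity_roots q - {1}))"
    using prod.union_disjoint[of "primitive_roots2 p q" "unity_roots p - {1} \<union> (unity_roots q - {1})" "\<lambda>z. 1 - z"]
      prod.union_disjoint[of "unity_roots p - {1}" "unity_roots q - {1}" "\<lambda>z. 1 - z"]
      fin finite_primitive_roots2 d by simp
  then show ?thesis using pq_pos by (simp add: g)
qed

text \<open>Raising to a power coprime to p q preserves the order: \<open>z ^ r\<close> lies in
  \<open>unity_roots s\<close> iff z is killed by gcd (r s, p q) = s.\<close>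

lemma bij_betw_primitive_roots2_power:
  assumes "coprime r p" "coprime r q"
  shows "bij_betw (\<lambda>z. z ^ r) (primitive_roots2 p q) (primitive_roots2 p q)"
proof -
  have bij: "bij_betw (\<lambda>z. z ^ r) (unity_roots (p * q)) (unity_roots (p * q))"
    using assms pq_pos by (intro bij_betw_unity_roots_power) auto
  have "z ^ r \<in> unity_roots s \<longleftrightarrow> z \<in> unity_roots s" if "z \<in> unity_roots (p * q)" "s = p \<or> s = q" for z s
  proof -
    have "gcd (r * p) (p * q) = p" "gcd (r * q) (p * q) = q"
      using assms pq_coprime gcd_mult_distrib_nat[of p r q] gcd_mult_distrib_nat[of q r p]
      by (simp_all add: mult.commute)
    then have "gcd (r * s) (p * q) = s" using that(2) by blast
    then have "z \<in> unity_roots (r * s) \<inter> unity_roots (p * q) \<longleftrightarrow> z \<in> unity_roots s"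
      by (simp only: unity_roots_Int)
    with that(1) show ?thesis by (simp add: unity_roots_def power_mult)
  qed
  then have "(\<lambda>z. z ^ r) ` primitive_roots2 p q \<subseteq> primitive_roots2 p q"
    using bij by (auto simp: primitive_roots2_def bij_betw_def)
  moreover have "inj_on (\<lambda>z. z ^ r) (primitive_roots2 p q)"
    by (rule inj_on_subset[OF bij_betw_imp_inj_on[OF bij]]) (auto simp: primitive_roots2_def)
  ultimately show ?thesis by (simp add: bij_betw_def endo_inj_surj finite_primitive_roots2)
qed

lemma sum_primitive_roots2_ge:
  assumes r: "prime r" "p \<noteq> r" "q \<noteq> r" and f: "f = one_minus_X_pow 1 * cyclotomic (p * q * r)"
  shows "(real r)\<^sup>2 * (real p - 1) * (real q - 1) \<le> (\<Sum>z\<in>primitive_roots2 p q. (cmod (poly f z))\<^sup>2)"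
proof -
  let ?V = one_minus_X_pow
  let ?S = "primitive_roots2 p q"
  have r0: "r > 0" and cop: "coprime r p" "coprime r q"
    using r pq by (auto simp: prime_gt_0_nat primes_coprime)
  \<comment> \<open>Both sides of \<open>cyclotomic_identity\<close> vanish at these z, so 1 - X^(p
    q) is cancelled before evaluation; its cofactor in 1 - X^(p q r) takes the value r
    there.\<close>
  have "?V (p * q) * (f * (?V (p * r) * ?V (q * r)))
      = ?V (p * q) * ((\<Sum>i<r. monom 1 (p * q * i)) * ?V p * ?V q * ?V r)"
    using cyclotomic_identity[OF pq(1,2) r(1) pq(3) r(2,3)] one_minus_X_pow_mult[of "p * q" r]
    unfolding f by (simp add: mult_ac)
  then have id: "f * (?V (p * r) * ?V (q * r)) = (\<Sum>i<r. monom 1 (p * q * i)) * ?V p * ?V q * ?V r"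
    using pq_pos by (simp add: one_minus_X_pow_0_iff)
  define t where "t = (\<lambda>z. cmod (poly f z) / r)"
  have t: "cmod (poly f z) = r * t z" for z using r0 by (simp add: t_def)
  have eq: "t z * (cmod (1 - (z ^ r) ^ p) * cmod (1 - (z ^ r) ^ q))
      = cmod (1 - z ^ p) * cmod (1 - z ^ q) * cmod (1 - z ^ r)" if "z \<in> ?S" for z
  proof -
    have "z ^ (p * q) = 1" using that by (simp add: primitive_roots2_def unity_roots_def)
    then have "poly f z * ((1 - z ^ (p * r)) * (1 - z ^ (q * r))) = of_nat r * (1 - z ^ p) * (1 - z ^ q) * (1 - z ^ r)"
      using arg_cong[OF id, of "\<lambda>g. poly g z"] by (simp add: poly_sum poly_monom power_mult)
    from arg_cong[OF this, of cmod]
    have "r * t z * (cmod (1 - z ^ (p * r)) * cmod (1 - z ^ (q * r)))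
        = r * cmod (1 - z ^ p) * cmod (1 - z ^ q) * cmod (1 - z ^ r)"
      using r0 by (simp only: norm_mult norm_of_nat t)
    then have "t z * (cmod (1 - z ^ (p * r)) * cmod (1 - z ^ (q * r)))
        = cmod (1 - z ^ p) * cmod (1 - z ^ q) * cmod (1 - z ^ r)"
      using r0 unfolding mult.assoc by simp
    then show ?thesis by (simp only: power_mult[symmetric] mult.commute[of r])
  qed
  have nz: "1 - z ^ p \<noteq> 0" "1 - z ^ q \<noteq> 0" if "z \<in> ?S" for z
    using that by (auto simp: primitive_roots2_def unity_roots_def)
  have bij: "bij_betw (\<lambda>z. z ^ r) ?S ?S" by (rule bij_betw_primitive_roots2_power[OF cop])
  have one: "(\<Prod>z\<in>?S. cmod (1 - z ^ r)) = 1"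
    using prod.reindex_bij_betw[OF bij, of "\<lambda>z. cmod (1 - z)"] prod_primitive_roots2
    by (simp add: prod_norm)
  \<comment> \<open>A zero factor would make the product 0 instead of 1.\<close>
  have nz': "1 - z ^ r \<noteq> 0" if "z \<in> ?S" for z
    using one that finite_primitive_roots2 by (metis norm_zero prod_zero zero_neq_one)
  have pos: "t z > 0" if "z \<in> ?S" for z
  proof -
    have "t z \<noteq> 0" using eq[OF that] nz[OF that] nz'[OF that] by auto
    moreover have "t z \<ge> 0" by (simp add: t_def)
    ultimately show ?thesis by simp
  qed
  have "prod t ?S * ((\<Prod>z\<in>?S. cmod (1 - (z ^ r) ^ p)) * (\<Prod>z\<in>?S. cmod (1 - (z ^ r) ^ q)))
      = (\<Prod>z\<in>?S. cmod (1 - z ^ p)) * (\<Prod>z\<in>?S. cmod (1 - z ^ q)) * (\<Prod>z\<in>?S. cmod (1 - z ^ r))"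
    unfolding prod.distrib[symmetric] by (rule prod.cong) (simp_all add: eq)
  also have "(\<Prod>z\<in>?S. cmod (1 - (z ^ r) ^ p)) = (\<Prod>z\<in>?S. cmod (1 - z ^ p))"
    by (rule prod.reindex_bij_betw[OF bij])
  also have "(\<Prod>z\<in>?S. cmod (1 - (z ^ r) ^ q)) = (\<Prod>z\<in>?S. cmod (1 - z ^ q))"
    by (rule prod.reindex_bij_betw[OF bij])
  finally have "prod t ?S = 1"
    using nz finite_primitive_roots2 by (simp add: one)
  then have "real (card ?S) \<le> (\<Sum>z\<in>?S. (t z)\<^sup>2)" using pos by (intro sum_power2_ge_card)
  also have "\<dots> = (\<Sum>z\<in>?S. (cmod (poly f z))\<^sup>2) / r\<^sup>2"
    by (simp add: t_def power_divide sum_divide_distrib)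
  finally show ?thesis
    using r0 pq_pos by (simp add: card_primitive_roots2 field_simps of_nat_diff)
qed

end

section \<open>Numerical estimates\<close>

text \<open>The difference of the two sides is an explicit combination of squares with nonnegative
  weights.\<close>

lemma arith_geo_mean3:
  fixes x y z :: real
  assumes "x \<ge> 0" "y \<ge> 0" "z \<ge> 0"
  shows "27 * (x * y * z) \<le> (x + y + z) ^ 3"
proof -
  have "(x + y + z) ^ 3 - 27 * (x * y * z) =
      (x + y + z) * ((x - y)\<^sup>2 + (y - z)\<^sup>2 + (z - x)\<^sup>2) / 2
      + 3 * (x * (y - z)\<^sup>2 + y * (z - x)\<^sup>2 + z * (x - y)\<^sup>2)"
    by (simp add: power2_eq_square power3_eq_cube field_simps)
  also have "\<dots> \<ge> 0" using assms by (intro add_nonneg_nonneg divide_nonneg_nonneg mult_nonneg_nonneg) auto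
  finally show ?thesis by simp
qed

text \<open>The tangent at \<open>t = 0\<close> reduces the cubic inequalities of the small cases to
  linear ones.\<close>

lemma cube_ge_tangent:
  fixes a b t :: real
  assumes "a \<ge> 0" "b \<ge> 0" "t \<ge> 0"
  shows "a ^ 3 + 3 * a\<^sup>2 * b * t \<le> (a + b * t) ^ 3"
proof -
  have "(a + b * t) ^ 3 - (a ^ 3 + 3 * a\<^sup>2 * b * t) = (b * t)\<^sup>2 * (3 * a + b * t)"
    by (simp add: power2_eq_square power3_eq_cube algebra_simps)
  also have "\<dots> \<ge> 0" using assms by simp
  finally show ?thesis by simp
qed

text \<open>The lower bound for the part of the Parseval sum coming from the roots of orders p q, p
  r and q r.\<close>

definition spectral_sum :: "real \<Rightarrow> real \<Rightarrow> real \<Rightarrow> real" where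
  "spectral_sum p q r = r\<^sup>2 * (p - 1) * (q - 1) + q\<^sup>2 * (p - 1) * (r - 1) + p\<^sup>2 * (q - 1) * (r - 1)"

text \<open>The constant only has to satisfy \<open>27 * 0.545\<^sup>2 > 8\<close>.\<close>

lemma cube_gt_if_totient_large:
  fixes p q r J :: real
  assumes "p > 1" "q > 1" "r > 1" and J: "spectral_sum p q r \<le> 2 * J * (p * q * r)"
    and phi: "0.545 * (p * q * r) \<le> (p - 1) * (q - 1) * (r - 1)"
  shows "p * q * r < J ^ 3"
proof -
  let ?n = "p * q * r"
  let ?phi = "(p - 1) * (q - 1) * (r - 1)"
  have n: "?n > 0" using assms by simp
  \<comment> \<open>The three summands multiply to \<open>?n\<close> squared times
    \<open>?phi\<close> squared.\<close>
  have "27 * ((r\<^sup>2 * (p - 1) * (q - 1)) * (q\<^sup>2 * (p - 1) * (r - 1)) * (p\<^sup>2 * (q - 1) * (r - 1)))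
      \<le> (spectral_sum p q r) ^ 3"
    unfolding spectral_sum_def using assms by (intro arith_geo_mean3) auto
  also have "\<dots> \<le> (2 * J * ?n) ^ 3"
    using J assms by (intro power_mono) (auto simp: spectral_sum_def)
  finally have 1: "27 * ?n\<^sup>2 * ?phi\<^sup>2 \<le> 8 * J ^ 3 * ?n ^ 3"
    by (simp add: power2_eq_square power3_eq_cube mult_ac)
  have "(0.545 * ?n)\<^sup>2 \<le> ?phi\<^sup>2" using phi n by (intro power_mono) auto
  then have "27 * ?n\<^sup>2 * (0.545 * ?n)\<^sup>2 \<le> 27 * ?n\<^sup>2 * ?phi\<^sup>2" by (intro mult_left_mono) auto
  with 1 have "27 * ?n\<^sup>2 * (0.545 * ?n)\<^sup>2 \<le> 8 * J ^ 3 * ?n ^ 3" by linarith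
  then have "?n ^ 3 * (27 * 0.545\<^sup>2 * ?n) \<le> ?n ^ 3 * (8 * J ^ 3)"
    by (simp add: power2_eq_square power3_eq_cube mult_ac)
  then have "27 * 0.545\<^sup>2 * ?n \<le> 8 * J ^ 3"
    using n by (subst (asm) mult_le_cancel_left_pos) auto
  then show ?thesis using n by (simp add: power2_eq_square)
qed

lemma cube_gt_sorted:
  fixes p q r J :: nat
  assumes prime: "prime p" "prime q" "prime r" and odd: "odd p" "odd q" "odd r" and less: "p < q" "q < r"
    and J: "spectral_sum p q r \<le> 2 * J * (p * q * r)"
  shows "p * q * r < J ^ 3"
proof -
  \<comment> \<open>Parity alone would admit 9; excluding it moves the next candidate after 7 up to
    11.\<close>
  have no9: "x \<noteq> 9" if "prime x" for x :: nat
  proof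
    assume "x = 9"
    moreover have "(3 :: nat) dvd 9" by simp
    ultimately have "(3 :: nat) = 1 \<or> (3 :: nat) = 9" using that unfolding prime_nat_iff by blast
    then show False by simp
  qed
  have p3: "p \<ge> 3" using prime_ge_2_nat[OF prime(1)] odd(1) by (cases "p = 2") auto
  have odd_le: "x + 2 \<le> y" if "odd x" "odd y" "x < y" for x y :: nat
    using that by presburger
  have q5: "q \<ge> p + 2" and r7: "r \<ge> q + 2" using odd_le odd less by auto
  have J': "spectral_sum (real p) (real q) (real r) \<le> 2 * real J * (real p * real q * real r)"
    using J by simp
  have big: ?thesis if "0.545 * (real p * real q * real r) \<le> (real p - 1) * (real q - 1) * (real r - 1)"
  proof -
    have "real p * real q * real r < real J ^ 3"
      by (rule cube_gt_if_totient_large[OF _ _ _ J' that]) (use p3 q5 r7 in auto)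
    then have "real (p * q * r) < real (J ^ 3)" by simp
    then show ?thesis by (simp only: of_nat_less_iff)
  qed
  \<comment> \<open>1 - 1/x increases with x, so its value at a lower bound for x suffices.\<close>
  have factor: "s * real x \<le> real x - 1" if "x \<ge> k" "k \<ge> 1" "s = 1 - 1 / k" for x k :: nat and s
  proof -
    have "1 \<le> real x / real k" using that by simp
    then show ?thesis unfolding that(3) by (simp add: algebra_simps)
  qed
  consider "p \<ge> 5" | "p = 3" "q \<ge> 11" | "p = 3" "q = 7" | "p = 3" "q = 5"
  proof -
    have "p = 3 \<or> p \<ge> 5" using p3 odd(1) by presburger
    moreover have "q = 5 \<or> q = 7 \<or> q = 9 \<or> q \<ge> 11" if "p = 3" using q5 odd(2) that by presburger
    ultimately show ?thesis using that no9[OF prime(2)] by blast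
  qed
  then show ?thesis
  proof cases
    case 1
    have "0.545 * (real p * real q * real r) \<le> (4/5 * real p) * (6/7 * real q) * (8/9 * real r)"
      by simp
    also have "\<dots> \<le> (real p - 1) * (real q - 1) * (real r - 1)"
      using factor[of 5 p "4/5"] factor[of 7 q "6/7"] factor[of 9 r "8/9"] 1 q5 r7
      by (intro mult_mono) auto
    finally show ?thesis by (rule big)
  next
    case 2
    \<comment> \<open>The constant product is about 0.559. For the primes 3, 7, 11 it would be about
      0.519, so \<open>q = 7\<close> is treated separately.\<close>
    have "0.545 * (real p * real q * real r) \<le> (2/3 * real p) * (10/11 * real q) * (12/13 * real r)"
      by simp
    also have "\<dots> \<le> (real p - 1) * (real q - 1) * (real r - 1)"
      using factor[of 3 p "2/3"] factor[of 11 q "10/11"] factor[of 13 r "12/13"] 2 r7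
      by (intro mult_mono) auto
    finally show ?thesis by (rule big)
  next
    case 3
    have r: "r \<ge> 11" using r7 odd(3) no9[OF prime(3)] 3 by presburger
    define t where "t = real r - 11"
    have t: "t \<ge> 0" "real r = t + 11" using r by (auto simp: t_def)
    have "12 * (real r)\<^sup>2 + 152 * real r - 152 \<le> 42 * real J * real r"
      using J' unfolding spectral_sum_def 3 by (simp add: algebra_simps)
    also have "\<dots> = real r * (42 * real J)" by simp
    \<comment> \<open>Here 138 = 152 - 14, and 152 <= 14 r because r >= 11.\<close>
    finally have "real r * (12 * real r + 138) \<le> real r * (42 * real J)"
      using r by (simp add: power2_eq_square algebra_simps)
    then have "12 * real r + 138 \<le> 42 * real J" using r by (subst (asm) mult_le_cancel_left_pos) auto
    \<comment> \<open>At r = 11 the bound is 270/42, rounded down to 6.4; the slope is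
      12/42.\<close>
    then have "6.4 + 2 / 7 * t \<le> real J" using t by simp
    then have "(6.4 + 2 / 7 * t) ^ 3 \<le> real J ^ 3" using t by (intro power_mono) auto
    moreover have "21 * (t + 11) < (6.4 + 2 / 7 * t) ^ 3"
      using cube_ge_tangent[of "6.4" "2 / 7" t] t by (simp add: power2_eq_square power3_eq_cube)
    ultimately have "21 * (t + 11) < real J ^ 3" by (rule order_less_le_trans[rotated])
    then have "real (p * q * r) < real (J ^ 3)" using t 3 by simp
    then show ?thesis by (simp only: of_nat_less_iff)
  next
    case 4
    have J4: "8 * (real r)\<^sup>2 + 86 * real r - 86 \<le> 30 * real J * real r"
      using J' unfolding spectral_sum_def 4 by (simp add: algebra_simps)
    have "r = 7 \<or> r \<ge> 11" using r7 odd(3) no9[OF prime(3)] 4 by presburger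
    then show ?thesis
    proof
      assume r: "r = 7"
      \<comment> \<open>The estimate gives only \<open>J \<ge> 4.32\<close>, less than the cube root of 105: integrality is needed.\<close>
      then have "4 < real J" using J4 by simp
      then have "5 \<le> J" by linarith
      then have "5 ^ 3 \<le> J ^ 3" by (rule power_mono) simp
      then show ?thesis using r 4 by simp
    next
      assume r: "r \<ge> 11"
      define t where "t = real r - 11"
      have t: "t \<ge> 0" "real r = t + 11" using r by (auto simp: t_def)
      \<comment> \<open>Here 78 = 86 - 8, and 86 <= 8 r because r >= 11.\<close>
      have "real r * (8 * real r + 78) \<le> real r * (30 * real J)"
        using J4 r by (simp add: power2_eq_square algebra_simps)
      then have "8 * real r + 78 \<le> 30 * real J" using r by (subst (asm) mult_le_cancel_left_pos) auto
      \<comment> \<open>At r = 11 the bound is 166/30. Rounding to 5.5 is tight: its cube 166.375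
        barely exceeds 15 * 11 = 165.\<close>
      then have "5.5 + 4 / 15 * t \<le> real J" using t by simp
      then have "(5.5 + 4 / 15 * t) ^ 3 \<le> real J ^ 3" using t by (intro power_mono) auto
      moreover have "15 * (t + 11) < (5.5 + 4 / 15 * t) ^ 3"
      using cube_ge_tangent[of "5.5" "4 / 15" t] t by (simp add: power2_eq_square power3_eq_cube)
      ultimately have "15 * (t + 11) < real J ^ 3" by (rule order_less_le_trans[rotated])
      then have "real (p * q * r) < real (J ^ 3)" using t 4 by simp
      then show ?thesis by (simp only: of_nat_less_iff)
    qed
  qed
qed

lemma cube_gt:
  fixes p q r J :: nat
  assumes "prime p" "prime q" "prime r" "odd p" "odd q" "odd r" "p \<noteq> q" "p \<noteq> r" "q \<noteq> r"
    and "spectral_sum p q r \<le> 2 * J * (p * q * r)"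
  shows "p * q * r < J ^ 3"
proof -
  have sym: "spectral_sum a b c = spectral_sum b a c" "spectral_sum a b c = spectral_sum a c b" for a b c
    by (simp_all add: spectral_sum_def)
  note * = cube_gt_sorted[of _ _ _ J]
  consider "p < q" "q < r" | "p < r" "r < q" | "q < p" "p < r" | "q < r" "r < p" | "r < p" "p < q" | "r < q" "q < p"
    using assms by linarith
  then show ?thesis
  proof cases
    case 1 then show ?thesis using *[of p q r] assms by simp
  next
    case 2 then show ?thesis using *[of p r q] assms sym by (simp add: mult_ac)
  next
    case 3 then show ?thesis using *[of q p r] assms sym by (simp add: mult_ac)
  next
    case 4 then show ?thesis using *[of q r p] assms sym by (simp add: mult_ac)
  next
    case 5 then show ?thesis using *[of r p q] assms sym by (simp add: mult_ac)
  next
    case 6 then show ?thesis using *[of r q p] assms sym by (simp add: mult_ac)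
  qed
qed

section \<open>The lower bound\<close>

text \<open>Both p and n fail to be coprime to n, so at least two indices are missing and the factor
  1 - x keeps the degree below n, as Parseval requires.\<close>

lemma degree_one_minus_X_cyclotomic:
  assumes "prime p" "p dvd n" "p < n"
  shows "degree (one_minus_X_pow 1 * cyclotomic n) < n"
proof -
  let ?S = "{m. 1 \<le> m \<and> m \<le> n \<and> coprime m n}"
  have p: "p > 1" using assms(1) prime_gt_1_nat by simp
  have sub: "?S \<subseteq> {1..n} - {p, n}"
    using assms p by (auto dest: coprime_common_divisor_nat simp: coprime_absorb_left)
  have "degree (cyclotomic n) \<le> sum (degree \<circ> (\<lambda>m. [:- exp (2 * of_real pi * \<i> * of_nat m / of_nat n), 1:])) ?S"
    unfolding cyclotomic_def by (rule degree_prod_sum_le) (rule finite_subset[OF sub], simp)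
  also have "\<dots> = card ?S" by simp
  also have "\<dots> \<le> card ({1..n} - {p, n})" by (rule card_mono[OF _ sub]) simp
  also have "\<dots> = n - 2" using assms p by (subst card_Diff_subset) auto
  finally have "degree (cyclotomic n) \<le> n - 2" .
  moreover have "degree (one_minus_X_pow 1) \<le> 1"
    unfolding one_minus_X_pow_def by (rule degree_diff_le) (auto simp: degree_monom_le)
  ultimately have "degree (one_minus_X_pow 1 * cyclotomic n) \<le> 1 + (n - 2)"
    using degree_mult_le[of "one_minus_X_pow 1" "cyclotomic n"] by linarith
  also have "\<dots> < n" using p assms(3) by simp
  finally show ?thesis .
qed

lemma sum_norm_coeff_eq_num_jumping_up:
  assumes deg: "degree (one_minus_X_pow 1 * cyclotomic n) < n"
    and bound: "\<And>k. k < int n \<Longrightarrow> int_coeff (one_minus_X_pow 1 * cyclotomic n) k \<in> {-1, 0, 1}"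
  shows "(\<Sum>k<n. (cmod (coeff (one_minus_X_pow 1 * cyclotomic n) k))\<^sup>2) = 2 * real (num_jumping_up n)"
proof -
  define f where "f = one_minus_X_pow 1 * cyclotomic n"
  let ?K = "{k \<in> {..<n}. coeff f k = 1}"
  have jump: "jumping_up n k \<longleftrightarrow> int_coeff f k = 1" for k
  proof -
    have "int_coeff f k = cyclotomic_coeff n k - cyclotomic_coeff n (k - 1)"
      unfolding f_def int_coeff_one_minus_X_pow_mult by (simp add: int_coeff_def cyclotomic_coeff_def)
    then show ?thesis unfolding jumping_up_def by (metis add.commute diff_add_cancel add_diff_cancel_left')
  qed
  have "{k. jumping_up n k} = int ` ?K"
  proof (intro set_eqI iffI)
    fix k assume "k \<in> {k. jumping_up n k}"
    then have k: "k \<ge> 0" "coeff f (nat k) = 1" by (auto simp: jump int_coeff_def split: if_splits)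
    then have "nat k < n" using deg le_degree[of f "nat k"] by (simp add: f_def)
    with k show "k \<in> int ` ?K" by (intro image_eqI[of _ _ "nat k"]) auto
  qed (auto simp: jump int_coeff_def)
  then have J: "num_jumping_up n = card ?K"
    unfolding num_jumping_up_def by (simp add: card_image)
  have "(\<Sum>k<n. coeff f k) = poly f 1"
    unfolding poly_altdef using deg
    by (intro sum.mono_neutral_cong_right) (auto simp: coeff_eq_0 f_def)
  also have "\<dots> = 0" by (simp add: f_def)
  finally have sum0: "(\<Sum>k<n. Re (coeff f k)) = 0" by (metis Re_sum zero_complex.sel(1))
  \<comment> \<open>On {-1, 0, 1} one has c^2 = 2 [c = 1] - c, and the linear term sums to f(1) =
    0.\<close>
  have "(cmod (coeff f k))\<^sup>2 = 2 * of_bool (coeff f k = 1) - Re (coeff f k)" if "k < n" for k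
    using bound[of "int k"] that by (auto simp: int_coeff_def f_def)
  then have "(\<Sum>k<n. (cmod (coeff f k))\<^sup>2) = (\<Sum>k<n. 2 * of_bool (coeff f k = 1) - Re (coeff f k))"
    by (intro sum.cong) auto
  also have "\<dots> = 2 * (\<Sum>k<n. of_bool (coeff f k = 1))"
    by (simp add: sum_subtractf sum0 sum_distrib_left)
  also have "(\<Sum>k<n. of_bool (coeff f k = 1)) = real (card ?K)"
    by (simp add: of_bool_def sum.If_cases Int_def)
  finally show ?thesis by (simp add: J f_def)
qed

text \<open>The roots of orders p q, p r and q r form disjoint sets; the other n-th roots contribute
  nonnegative squares to the Parseval sum and are dropped.\<close>

lemma spectral_sum_le:
  fixes p q r :: nat
  assumes pr: "prime p" "prime q" "prime r" "p \<noteq> q" "p \<noteq> r" "q \<noteq> r"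
  shows "spectral_sum p q r \<le> 2 * num_jumping_up (p * q * r) * (p * q * r)"
proof -
  let ?n = "p * q * r"
  define f where "f = one_minus_X_pow 1 * cyclotomic ?n"
  let ?g = "\<lambda>z. (cmod (poly f z))\<^sup>2"
  let ?A = "primitive_roots2 p q" and ?B = "primitive_roots2 p r" and ?C = "primitive_roots2 q r"
  have pos: "p > 0" "q > 1" "r > 1" using pr by (auto simp: prime_gt_0_nat prime_gt_Suc_0_nat)
  have "p * 1 < p * (q * r)" using pos less_1_mult[of q r] by (intro mult_strict_left_mono) auto
  then have deg: "degree f < ?n"
    unfolding f_def by (intro degree_one_minus_X_cyclotomic[OF pr(1)]) (auto simp: mult.assoc)
  have cop: "coprime p q" "coprime p r" "coprime q r"
    using pr by (auto simp: primes_coprime)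
  have "gcd (p * q) (p * r) = p" "gcd (p * q) (q * r) = q" "gcd (p * r) (q * r) = r"
    using cop gcd_mult_distrib_nat[of p q r] gcd_mult_distrib_nat[of q p r] gcd_mult_distrib_nat[of r p q]
    by (simp_all add: mult.commute)
  then have "unity_roots (p * q) \<inter> unity_roots (p * r) = unity_roots p"
      "unity_roots (p * q) \<inter> unity_roots (q * r) = unity_roots q"
      "unity_roots (p * r) \<inter> unity_roots (q * r) = unity_roots r"
    by (simp_all add: unity_roots_Int)
  then have disj: "?A \<inter> ?B = {}" "(?A \<union> ?B) \<inter> ?C = {}"
    unfolding primitive_roots2_def by blast+
  have "?A \<union> ?B \<union> ?C \<subseteq> unity_roots ?n"
    by (auto simp: primitive_roots2_def unity_roots_def) (metis mult.assoc mult.commute power_mult power_one)+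
  have fin: "finite ?A" "finite ?B" "finite ?C"
    using pr by (auto intro: finite_primitive_roots2)
  have "(real r)\<^sup>2 * (real p - 1) * (real q - 1) \<le> sum ?g ?A"
    by (rule sum_primitive_roots2_ge) (use pr in \<open>auto simp: f_def\<close>)
  moreover have "(real q)\<^sup>2 * (real p - 1) * (real r - 1) \<le> sum ?g ?B"
    by (rule sum_primitive_roots2_ge) (use pr in \<open>auto simp: f_def mult_ac\<close>)
  moreover have "(real p)\<^sup>2 * (real q - 1) * (real r - 1) \<le> sum ?g ?C"
    by (rule sum_primitive_roots2_ge) (use pr in \<open>auto simp: f_def mult_ac\<close>)
  ultimately have "spectral_sum p q r \<le> sum ?g (?A \<union> ?B \<union> ?C)"
    unfolding spectral_sum_def using fin disj by (simp add: sum.union_disjoint)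
  also have "\<dots> \<le> sum ?g (unity_roots ?n)"
    by (rule sum_mono2) (use \<open>?A \<union> ?B \<union> ?C \<subseteq> unity_roots ?n\<close> pos in \<open>auto simp: finite_unity_roots\<close>)
  also have "\<dots> = ?n * (\<Sum>k<?n. (cmod (coeff f k))\<^sup>2)"
    by (rule parseval_unity_roots[OF deg])
  also have "\<dots> = 2 * num_jumping_up ?n * ?n"
    using sum_norm_coeff_eq_num_jumping_up[OF deg[unfolded f_def] int_coeff_cyclotomic[OF pr]]
    by (simp add: f_def)
  finally show ?thesis by simp
qed

theorem theorem1p1:
  fixes n p q r :: nat
  assumes "prime p" and "prime q" and "prime r"
    and "odd p" and "odd q" and "odd r"
    and "p \<noteq> q" and "p \<noteq> r" and "q \<noteq> r"
    and "n = p * q * r"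
  shows "real (num_jumping_up n) > real n powr (1 / 3)"
proof -
  let ?J = "num_jumping_up n"
  have "spectral_sum p q r \<le> 2 * ?J * (p * q * r)"
    using spectral_sum_le[of p q r] assms by simp
  then have "n < ?J ^ 3"
    using cube_gt[of p q r ?J] assms by simp
  then have lt: "real n < real ?J ^ 3" by (metis of_nat_less_iff of_nat_power)
  then have "?J > 0" by (cases "?J = 0") auto
  have "real n powr (1 / 3) < (real ?J ^ 3) powr (1 / 3)"
    using lt by (intro powr_less_mono2) auto
  also have "\<dots> = real ?J"
    using \<open>?J > 0\<close> by (simp add: powr_powr flip: powr_numeral)
  finally show ?thesis .
qed

end
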